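(* Let $a,b,c,d$ be complex numbers. Let $(t_{n,k})_{n,k\ge 0}$ be the Bell matrix which has $$A=\begin{pmatrix}1&a&b\\1&c&d\end{pmatrix}$$ as its $A$-matrix, with $\rho$ sequence $\rho_n=0$ for all $n\ge 0$. Then, with the convention $t_{n,k}=0$ if $k<0$ or $k>n$, we have $t_{0,0}=1$, $t_{1,0}=a+1$, and $$t_{n,k}=t_{n-1,k-1}+a\,t_{n-1,k}+b\,t_{n-1,k+1}+t_{n-2,k-1}+c\,t_{n-2,k}+d\,t_{n-2,k+1}$$ for all $n\ge 1$ and $0\le k\le n$ with $(n,k)\ne(1,0)$. Moreover, $(t_{n,k})$ is the Riordan array $$\left(\frac{1+x}{1-ax-cx^2}\,C\!\left(\frac{x^2(1+x)(b+dx)}{(1-ax-cx^2)^2}\right),\ \frac{x(1+x)}{1-ax-cx^2}\,C\!\left(\frac{x^2(1+x)(b+dx)}{(1-ax-cx^2)^2}\right)\right),$$ where $C(x)$ denotes the generating function of the Catalan numbers.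
   Context: All series are formal power series. A Riordan array $(g(x),f(x))$, where $g(x)=g_0+g_1x+\cdots$ with $g_0\ne 0$ and $f(x)=f_1x+f_2x^2+\cdots$ with $f_1\neq 0$, is the lower-triangular matrix with entries $t_{n,k}=[x^n]\,g(x)f(x)^k$, where $[x^n]$ extracts the coefficient of $x^n$. A Bell matrix is a Riordan array of the form $\left(\frac{f(x)}{x},f(x)\right)$. Given an array $(a_{i,j})_{i,j\ge 0}$ with $a_{0,0}\ne 0$ (the $A$-matrix; a finite matrix is regarded as extended by zeros) and a sequence $(\rho_j)_{j\ge 0}$, the Bell matrix having this $A$-matrix and $\rho$ sequence is $\left(\frac{f(x)}{x},f(x)\right)$, where $f(x)$ is the formal power series with $f(0)=0$ satisfying $$\frac{f(x)}{x}=\sum_{i\ge 0}x^iR^{(i)}(f(x))+\frac{f(x)^2}{x}\rho(f(x)),$$ with $R^{(i)}(x)=\sum_j a_{i,j}x^j$ the generating series of the $i$-th row of the $A$-matrix and $\rho(x)=\sum_j\rho_jx^j$. For the matrix $A$ of the statement and $\rho_n=0$ for all $n$, this means that $u=f(x)$ satisfies $\frac{u}{x}=1+au+bu^2+x(1+cu+du^2)$, $u(0)=0$. The Catalan generating function is $C(x)=\frac{1-\sqrt{1-4x}}{2x}=\sum_{n\ge0}\frac{1}{n+1}\binom{2n}{n}x^n$ (it is a different object from the scalar parameter $c$). *)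

theory Defs
  imports Complex_Main "HOL-Computational_Algebra.Formal_Power_Series"
begin

definition riordan_array :: "complex fps \<Rightarrow> complex fps \<Rightarrow> nat \<Rightarrow> nat \<Rightarrow> complex" where
  "riordan_array g f n k = fps_nth (g * f ^ k) n"

definition is_riordan_array ::
    "(nat \<Rightarrow> nat \<Rightarrow> complex) \<Rightarrow> complex fps \<Rightarrow> complex fps \<Rightarrow> bool" where
  "is_riordan_array t g f \<longleftrightarrow>
     fps_nth g 0 \<noteq> 0 \<and> fps_nth f 0 = 0 \<and> fps_nth f 1 \<noteq> 0 \<and> t = riordan_array g f"

definition bell_matrix :: "complex fps \<Rightarrow> nat \<Rightarrow> nat \<Rightarrow> complex" where
  "bell_matrix f = riordan_array (f / fps_X) f"

text \<open>
  The defining equation of the series \<open>f\<close> attached to an A-matrix and a \<open>\<rho>\<close> sequence.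
  The sum over the rows is an infinite sum in the topology of formal power series; it always
  converges, since its \<open>i\<close>-th term is divisible by the \<open>i\<close>-th power of the variable.
  The requirement \<open>f(0) = 0\<close> makes the compositions and the quotients by the variable meaningful.
\<close>

definition bell_equation :: "(nat \<Rightarrow> nat \<Rightarrow> complex) \<Rightarrow> (nat \<Rightarrow> complex) \<Rightarrow> complex fps \<Rightarrow> bool" where
  "bell_equation A \<rho> f \<longleftrightarrow> fps_nth f 0 = 0 \<and>
     f / fps_X = (\<Sum>i. fps_X ^ i * (Abs_fps (A i) oo f)) + f\<^sup>2 / fps_X * (Abs_fps \<rho> oo f)"

text \<open>
  Multiplied by the variable, the equation expresses each coefficient of \<open>f\<close> in terms of the
  preceding ones (the linear coefficient being \<open>A 0 0\<close>), so it has exactly one solution.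
  The resulting array is a Riordan array provided that \<open>A 0 0 \<noteq> 0\<close>.
\<close>

definition bell_matrix_of ::
    "(nat \<Rightarrow> nat \<Rightarrow> complex) \<Rightarrow> (nat \<Rightarrow> complex) \<Rightarrow> nat \<Rightarrow> nat \<Rightarrow> complex" where
  "bell_matrix_of A \<rho> = bell_matrix (THE f. bell_equation A \<rho> f)"

definition array_of_rows :: "complex list list \<Rightarrow> nat \<Rightarrow> nat \<Rightarrow> complex" where
  "array_of_rows rows i j =
     (if i < length rows \<and> j < length (rows ! i) then rows ! i ! j else 0)"

text \<open>
  Integer indices, so that the convention \<open>t\<^sub>n\<^sub>,\<^sub>k = 0\<close> for \<open>k < 0\<close> or \<open>k > n\<close> can be applied
  to the indices \<open>k - 1\<close> and \<open>n - 2\<close>; in particular the rows with \<open>n < 0\<close> vanish.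
\<close>

definition entry :: "(nat \<Rightarrow> nat \<Rightarrow> complex) \<Rightarrow> int \<Rightarrow> int \<Rightarrow> complex" where
  "entry t n k = (if k < 0 \<or> k > n then 0 else t (nat n) (nat k))"

definition catalan_gf :: "complex fps" where
  "catalan_gf = Abs_fps (\<lambda>n. of_nat ((2 * n) choose n) / of_nat (n + 1))"

end

theory Submission
  imports Defs
begin

text \<open>
  Multiplied by \<open>x\<close>, the equation defining the Bell matrix becomes the polynomial equation
  \<open>f = x (1 + a f + b f\<^sup>2) + x\<^sup>2 (1 + c f + d f\<^sup>2)\<close>. Both claims are readings of it.

  The entry \<open>t\<^sub>n\<^sub>,\<^sub>k\<close> is the coefficient of \<open>x ^ (n + 1)\<close> in \<open>f ^ (k + 1)\<close>. Hence multiplying the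
  polynomial equation by \<open>f ^ k\<close> and comparing coefficients gives the recurrence: each power of
  \<open>f\<close> on the right is a column, and each factor \<open>x\<close> a shift of the row index. This reading breaks
  down only for the constant series \<open>f ^ 0 = 1\<close>, whose coefficient \<open>1\<close> would be the entry in
  position \<open>(-1, -1)\<close>; for \<open>n \<ge> 1\<close> it enters exactly when \<open>(n, k) = (1, 0)\<close>, which explains that
  exception and the extra summand in \<open>t\<^sub>1\<^sub>,\<^sub>0 = a + 1\<close>.

  Collecting the terms linear in \<open>f\<close> turns the equation into \<open>f = p + q f\<^sup>2\<close> with
  \<open>p = x (1 + x) / D\<close>, \<open>q = x (b + d x) / D\<close> and \<open>D = 1 - a x - c x\<^sup>2\<close>. Since the Catalan series
  satisfies \<open>C = 1 + x C\<^sup>2\<close> (\<open>catalan_gf_functional_equation\<close>), one solution is \<open>p C(p q)\<close>; there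
  is no other, because the second root of the quadratic has no power series expansion when \<open>q\<close>
  has no constant term (\<open>fps_quadratic_iff_catalan\<close>).
\<close>

section \<open>The functional equation of the Catalan series\<close>

lemma central_binomial_Suc:
  "Suc n * (2 * Suc n choose Suc n) = 2 * (2 * n + 1) * (2 * n choose n)"
  by (metis (lifting) ext Suc_eq_plus1 Suc_times_binomial_add
    Suc_times_binomial_eq add_Suc_right add_Suc_shift mult.commute
    mult.left_commute mult_2)

lemma catalan_gf_Suc:
  "of_nat (n + 2) * fps_nth catalan_gf (Suc n) = of_nat (4 * n + 2) * fps_nth catalan_gf n"
proof -
  let ?u = "of_nat (2 * n choose n) :: complex" and ?v = "of_nat (2 * Suc n choose Suc n) :: complex"
  have "of_nat (Suc n) * ?v = of_nat (4 * n + 2) * ?u"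
    using central_binomial_Suc[of n] unfolding of_nat_mult[symmetric] of_nat_eq_iff by simp
  then have "?v = of_nat (4 * n + 2) * ?u / of_nat (Suc n)"
    by (simp only: eq_divide_eq of_nat_eq_0_iff mult.commute) simp
  moreover have "of_nat (n + 2) \<noteq> (0::complex)"
    unfolding of_nat_eq_0_iff by simp
  then have "of_nat (n + 2) * fps_nth catalan_gf (Suc n) = ?v"
    by (simp add: catalan_gf_def del: mult_Suc_right)
  ultimately show ?thesis
    by (simp add: catalan_gf_def del: mult_Suc_right)
qed

lemma catalan_gf_nth_0: "fps_nth catalan_gf 0 = 1"
  by (simp add: catalan_gf_def)

text \<open>
  The series \<open>S = 1 - 2 x C\<close> should be the square root of \<open>1 - 4 x\<close>. The two-term recurrence of the
  Catalan numbers says that \<open>(1 - 4 x) S' = - 2 S\<close>, so that \<open>T = S\<^sup>2\<close> satisfies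
  \<open>(1 - 4 x) T' = - 4 T\<close>; this differential equation determines \<open>T\<close> from its constant term.
\<close>

lemma catalan_gf_discriminant:
  "(1 - 2 * fps_X * catalan_gf)\<^sup>2 = 1 - 4 * fps_X"
proof -
  define S :: "complex fps" where "S = 1 - 2 * fps_X * catalan_gf"
  have S_Suc: "fps_nth S (Suc n) = - 2 * fps_nth catalan_gf n" for n
    by (simp add: S_def mult.assoc numeral_fps_const)
  have S_0: "fps_nth S 0 = 1"
    by (simp add: S_def)
  have S_ode: "(1 - 4 * fps_X) * fps_deriv S = - 2 * S"
  proof (rule fps_ext)
    fix n
    show "fps_nth ((1 - 4 * fps_X) * fps_deriv S) n = fps_nth (- 2 * S) n"
    proof (cases n)
      case 0
      then show ?thesis
        using S_Suc[of 0] by (simp add: S_0 catalan_gf_nth_0)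
    next
      case (Suc m)
      then show ?thesis
        using catalan_gf_Suc[of m]
        by (simp add: S_Suc left_diff_distrib mult.assoc numeral_fps_const neg_numeral_fps_const
            algebra_simps)
    qed
  qed
  have T_ode: "(1 - 4 * fps_X) * fps_deriv (S\<^sup>2) = - 4 * S\<^sup>2"
  proof -
    have "(1 - 4 * fps_X) * fps_deriv (S\<^sup>2) = 2 * S * ((1 - 4 * fps_X) * fps_deriv S)"
      by (simp add: power2_eq_square algebra_simps)
    then show ?thesis
      by (simp add: S_ode power2_eq_square)
  qed
  have T_Suc: "of_nat (Suc n) * fps_nth (S\<^sup>2) (Suc n) = 4 * (of_nat n - 1) * fps_nth (S\<^sup>2) n" for n
    using arg_cong[OF T_ode, of "\<lambda>F. fps_nth F n"]
    by (cases n)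
      (simp_all add: left_diff_distrib mult.assoc numeral_fps_const neg_numeral_fps_const
        algebra_simps del: fps_deriv_power)
  have T_0: "fps_nth (S\<^sup>2) 0 = 1"
    by (simp add: S_0 fps_nth_power_0)
  have T_1: "fps_nth (S\<^sup>2) (Suc 0) = - 4"
    using T_Suc[of 0] T_0 by simp
  \<comment> \<open>The factor \<open>n - 1\<close> vanishes at \<open>n = 1\<close>, so the series breaks off after the linear term.\<close>
  have T_ge2: "fps_nth (S\<^sup>2) (Suc (Suc n)) = 0" for n
  proof (induction n)
    case 0
    then show ?case using T_Suc[of 1] by simp
  next
    case (Suc n)
    then show ?case using T_Suc[of "Suc (Suc n)"]
      by (metis mult_eq_0_iff of_nat_neq_0)
  qed
  have "S\<^sup>2 = 1 - 4 * fps_X"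
  proof (rule fps_ext)
    fix n
    show "fps_nth (S\<^sup>2) n = fps_nth (1 - 4 * fps_X) n"
      using T_0 T_1 T_ge2
      by (cases n; cases "n - 1") (simp_all add: numeral_fps_const)
  qed
  then show ?thesis
    by (simp add: S_def)
qed

lemma catalan_gf_functional_equation: "catalan_gf = 1 + fps_X * catalan_gf\<^sup>2"
proof -
  have "4 * fps_X * (1 + fps_X * catalan_gf\<^sup>2 - catalan_gf) = 0"
    using catalan_gf_discriminant by (simp add: power2_eq_square algebra_simps)
  then have "1 + fps_X * catalan_gf\<^sup>2 - catalan_gf = 0"
    by simp
  then show ?thesis
    by simp
qed

section \<open>Quadratic equations over power series\<close>

text \<open>
  Substituting \<open>p q\<close> into \<open>C = 1 + x C\<^sup>2\<close> and multiplying by \<open>p\<close> shows that \<open>p C(p q)\<close> is a solution.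
  The difference of two solutions \<open>f\<close> and \<open>g\<close> is annihilated by \<open>1 - q (f + g)\<close>, which is
  nonzero because its constant term is \<open>1\<close>.
\<close>

lemma fps_quadratic_iff_catalan:
  fixes p q f :: "complex fps"
  assumes p0: "fps_nth p 0 = 0" and q0: "fps_nth q 0 = 0"
  shows "f = p + q * f\<^sup>2 \<longleftrightarrow> f = p * (catalan_gf oo (p * q))"
proof -
  define K where "K = catalan_gf oo (p * q)"
  have pq0: "fps_nth (p * q) 0 = 0"
    using p0 by simp
  have "K = (1 + fps_X * catalan_gf\<^sup>2) oo (p * q)"
    unfolding K_def using catalan_gf_functional_equation by simp
  also have "\<dots> = 1 + p * q * K\<^sup>2"
    using pq0 by (simp add: K_def fps_compose_add_distrib fps_compose_mult_distrib
        fps_compose_power)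
  finally have K: "K = 1 + p * q * K\<^sup>2" .
  have sol: "p * K = p + q * (p * K)\<^sup>2"
    by (subst K) (simp add: power2_eq_square algebra_simps)
  have "f = p * K" if f: "f = p + q * f\<^sup>2"
  proof -
    have "f - p * K = q * f\<^sup>2 - q * (p * K)\<^sup>2"
      by (subst f, subst sol) simp
    then have "(f - p * K) * (1 - q * (f + p * K)) = 0"
      by (simp add: power2_eq_square algebra_simps)
    moreover have "fps_nth (1 - q * (f + p * K)) 0 = 1"
      using q0 by simp
    then have "1 - q * (f + p * K) \<noteq> 0"
      by (metis fps_zero_nth zero_neq_one)
    ultimately show ?thesis
      by simp
  qed
  with sol show ?thesis
    unfolding K_def by metis
qed

section \<open>Bell matrices\<close>

lemma fps_X_mult_divide_X:
  fixes f :: "complex fps"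
  assumes "fps_nth f 0 = 0"
  shows "fps_X * (f / fps_X) = f"
  by (rule fps_ext) (use assms in \<open>simp add: fps_div_fps_X_nth del: fps_divide_X\<close>)

lemma bell_matrix_eq_nth_power:
  assumes "fps_nth f 0 = 0"
  shows "bell_matrix f n k = fps_nth (f ^ Suc k) (Suc n)"
proof -
  have "f ^ Suc k = fps_X * (f / fps_X * f ^ k)"
    using fps_X_mult_divide_X[OF assms] by (metis mult.assoc power_Suc)
  then show ?thesis
    by (simp add: bell_matrix_def riordan_array_def del: power_Suc fps_divide_X)
qed

text \<open>
  In the shifted indices \<open>m = n + 1\<close> and \<open>j = k + 1\<close> the vanishing of the entries outside the triangle
  is automatic: a power of \<open>f\<close> is divisible by the same power of \<open>x\<close>, and the zeroth power has
  no coefficient besides the constant one.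
\<close>

lemma entry_bell_matrix:
  assumes f0: "fps_nth f 0 = 0" and "m \<noteq> 0 \<or> j \<noteq> 0"
  shows "entry (bell_matrix f) (int m - 1) (int j - 1) = fps_nth (f ^ j) m"
proof (cases "j = 0 \<or> m < j")
  case True
  then show ?thesis
    using assms startsby_zero_power_prefix[OF f0, of j] by (auto simp: entry_def)
next
  case False
  then obtain k n where "j = Suc k" "m = Suc n" "k \<le> n"
    by (metis Suc_le_mono gr0_conv_Suc leI less_nat_zero_code nat_neq_iff)
  then show ?thesis
    by (simp add: entry_def bell_matrix_eq_nth_power[OF f0] del: power_Suc)
qed

lemma bell_equation_two_rows_iff:
  fixes a b c d :: complex
  shows "bell_equation (array_of_rows [[1, a, b], [1, c, d]]) (\<lambda>n. 0) f \<longleftrightarrow>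
    fps_nth f 0 = 0 \<and>
    f = fps_X * (1 + fps_const a * f + fps_const b * f\<^sup>2)
      + fps_X\<^sup>2 * (1 + fps_const c * f + fps_const d * f\<^sup>2)"
proof (cases "fps_nth f 0 = 0")
  case f0: True
  let ?A = "array_of_rows [[1, a, b], [1, c, d]]"
  let ?P = "\<lambda>u v. 1 + fps_const u * fps_X + fps_const v * fps_X\<^sup>2 :: complex fps"
  have three: "Abs_fps (\<lambda>j. if j < 3 then [1, u, v] ! j else 0) = ?P u v" for u v
    by (rule fps_ext) (auto simp: fps_X_power_nth nth_Cons fps_X_nth split: nat.splits)
  have row0: "Abs_fps (?A 0) = ?P a b" and row1: "Abs_fps (?A 1) = ?P c d"
    using three[of a b] three[of c d]
    by (simp_all add: array_of_rows_def[abs_def] numeral_3_eq_3 cong: if_cong)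
  have rows: "Abs_fps (?A i) = 0" if "i \<ge> 2" for i
    using that by (intro fps_ext) (simp add: array_of_rows_def)
  have comp: "?P u v oo f = 1 + fps_const u * f + fps_const v * f\<^sup>2" for u v
    using f0 by (simp add: fps_compose_add_distrib fps_compose_mult_distrib fps_X_power_compose)
  have "(\<Sum>i. fps_X ^ i * (Abs_fps (?A i) oo f)) = (\<Sum>i\<in>{0, 1}. fps_X ^ i * (Abs_fps (?A i) oo f))"
  proof (rule suminf_finite)
    fix i :: nat
    assume "i \<notin> {0, 1}"
    then show "fps_X ^ i * (Abs_fps (?A i) oo f) = 0"
      using rows[of i] by simp
  qed simp
  also have "\<dots> = (?P a b oo f) + fps_X * (?P c d oo f)"
    using row0 row1 by simp
  finally have sum: "(\<Sum>i. fps_X ^ i * (Abs_fps (?A i) oo f)) =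
      (1 + fps_const a * f + fps_const b * f\<^sup>2)
      + fps_X * (1 + fps_const c * f + fps_const d * f\<^sup>2)" (is "_ = ?R")
    by (simp only: comp)
  have zero: "Abs_fps (\<lambda>n. 0 :: complex) = 0"
    by (rule fps_ext) simp
  have "f / fps_X = ?R \<longleftrightarrow> fps_X * (f / fps_X) = fps_X * ?R"
    by simp
  also have "\<dots> \<longleftrightarrow> f = fps_X * ?R"
    using fps_X_mult_divide_X[OF f0] by simp
  finally show ?thesis
    unfolding bell_equation_def sum zero using f0
    by (simp add: power2_eq_square algebra_simps del: fps_divide_X)
qed (simp add: bell_equation_def)

section \<open>The Bell matrix of a two-row A-matrix\<close>

theorem proposition8:
  fixes a b c d :: complex and t :: "nat \<Rightarrow> nat \<Rightarrow> complex"
  assumes "t = bell_matrix_of (array_of_rows [[1, a, b], [1, c, d]]) (\<lambda>n. 0)"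
  shows "t 0 0 = 1 \<and> t 1 0 = a + 1 \<and>
    (\<forall>n k :: int. n \<ge> 1 \<and> 0 \<le> k \<and> k \<le> n \<and> (n, k) \<noteq> (1, 0) \<longrightarrow>
       entry t n k =
         entry t (n - 1) (k - 1) + a * entry t (n - 1) k + b * entry t (n - 1) (k + 1)
         + entry t (n - 2) (k - 1) + c * entry t (n - 2) k + d * entry t (n - 2) (k + 1)) \<and>
    (let x = fps_X;
         D = 1 - fps_const a * x - fps_const c * x\<^sup>2;
         w = x\<^sup>2 * (1 + x) * (fps_const b + fps_const d * x) / D\<^sup>2
     in is_riordan_array t
          ((1 + x) / D * (catalan_gf oo w))
          (x * (1 + x) / D * (catalan_gf oo w)))"
proof -
  define D :: "complex fps" where "D = 1 - fps_const a * fps_X - fps_const c * fps_X\<^sup>2"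
  define w where "w = fps_X\<^sup>2 * (1 + fps_X) * (fps_const b + fps_const d * fps_X) / D\<^sup>2"
  define p where "p = fps_X * (1 + fps_X) / D"
  define q where "q = fps_X * (fps_const b + fps_const d * fps_X) / D"
  define f where "f = p * (catalan_gf oo w)"
  have D0: "fps_nth D 0 = 1"
    by (simp add: D_def)
  have D_inv: "D * inverse D = 1"
    using D0 by (simp add: inverse_mult_eq_1')
  have D_cancel: "D * h = R \<longleftrightarrow> h = inverse D * R" for h R
    using D_inv by (auto simp: mult.assoc[symmetric] mult.commute[of "inverse D"])
  have p: "p = fps_X * (1 + fps_X) * inverse D"
    and q: "q = fps_X * (fps_const b + fps_const d * fps_X) * inverse D"
    using D0 by (simp_all only: p_def q_def fps_divide_unit one_neq_zero not_False_eq_True)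
  have p0: "fps_nth p 0 = 0" and q0: "fps_nth q 0 = 0"
    by (simp_all add: p q)
  have w: "w = p * q"
    using D0 by (simp add: w_def p q fps_divide_unit fps_inverse_power power2_eq_square
        fps_inverse_mult mult_ac)
  have f0: "fps_nth f 0 = 0"
    using p0 by (simp add: f_def)

  have iff: "bell_equation (array_of_rows [[1, a, b], [1, c, d]]) (\<lambda>n. 0) h \<longleftrightarrow> h = f" for h
  proof -
    have "h = fps_X * (1 + fps_const a * h + fps_const b * h\<^sup>2)
        + fps_X\<^sup>2 * (1 + fps_const c * h + fps_const d * h\<^sup>2) \<longleftrightarrow>
      D * h = fps_X * (1 + fps_X) + fps_X * (fps_const b + fps_const d * fps_X) * h\<^sup>2"
      (is "_ \<longleftrightarrow> D * h = ?R")
      by (auto simp: D_def power2_eq_square algebra_simps)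
    also have "\<dots> \<longleftrightarrow> h = inverse D * ?R"
      by (rule D_cancel)
    also have "inverse D * ?R = p + q * h\<^sup>2"
      by (simp add: p q algebra_simps)
    also have "h = p + q * h\<^sup>2 \<longleftrightarrow> h = f"
      unfolding f_def w by (rule fps_quadratic_iff_catalan[OF p0 q0])
    finally show ?thesis
      unfolding bell_equation_two_rows_iff using f0 by auto
  qed
  then have t: "t = bell_matrix f"
    by (simp add: assms bell_matrix_of_def)
  have f_eq: "f = fps_X * (1 + fps_const a * f + fps_const b * f\<^sup>2)
      + fps_X\<^sup>2 * (1 + fps_const c * f + fps_const d * f\<^sup>2)"
    using iff[of f] bell_equation_two_rows_iff by blast

  have f1: "fps_nth f (Suc 0) = 1"
    by (subst f_eq) (simp add: f0 power2_eq_square mult.assoc)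
  have f2: "fps_nth f (Suc (Suc 0)) = a + 1"
    by (subst f_eq) (simp add: f0 f1 power2_eq_square mult.assoc fps_mult_nth_1)
  have t00: "t 0 0 = 1" and t10: "t 1 0 = a + 1"
    by (simp_all add: t bell_matrix_eq_nth_power[OF f0] f1 f2)

  have rec: "entry t n k =
         entry t (n - 1) (k - 1) + a * entry t (n - 1) k + b * entry t (n - 1) (k + 1)
         + entry t (n - 2) (k - 1) + c * entry t (n - 2) k + d * entry t (n - 2) (k + 1)"
    if nk: "n \<ge> 1" "0 \<le> k" "k \<le> n" "(n, k) \<noteq> (1, 0)" for n k :: int
  proof -
    obtain N where N: "n = int (Suc N)"
      using nk(1) by (metis Suc_eq_plus1 add.commute nonneg_int_cases of_nat_1 of_nat_Suc zle_iff_zadd)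
    obtain K where K: "k = int K"
      using nk(2) by (metis nonneg_int_cases)
    have NK: "N \<noteq> 0 \<or> K \<noteq> 0"
      using nk(4) by (auto simp: N K)
    have "f ^ Suc K = f ^ K * f"
      by simp
    also have "\<dots> = f ^ K * (fps_X * (1 + fps_const a * f + fps_const b * f\<^sup>2)
        + fps_X\<^sup>2 * (1 + fps_const c * f + fps_const d * f\<^sup>2))"
      using f_eq by simp
    also have "\<dots> = fps_X * (f ^ K + fps_const a * f ^ Suc K + fps_const b * f ^ Suc (Suc K)
        + fps_X * (f ^ K + fps_const c * f ^ Suc K + fps_const d * f ^ Suc (Suc K)))"
      by (simp add: power2_eq_square algebra_simps)
    finally have power_eq: "f ^ Suc K = \<dots>" .
    have "fps_nth (f ^ Suc K) (Suc (Suc N)) =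
        fps_nth (f ^ K) (Suc N) + a * fps_nth (f ^ Suc K) (Suc N)
        + b * fps_nth (f ^ Suc (Suc K)) (Suc N)
        + fps_nth (f ^ K) N + c * fps_nth (f ^ Suc K) N + d * fps_nth (f ^ Suc (Suc K)) N"
      using arg_cong[OF power_eq, of "\<lambda>F. fps_nth F (Suc (Suc N))"]
      by (simp add: algebra_simps del: power_Suc)
    moreover note
      entry_bell_matrix[OF f0, of "Suc (Suc N)" "Suc K"]
      entry_bell_matrix[OF f0, of "Suc N" K]
      entry_bell_matrix[OF f0, of "Suc N" "Suc K"]
      entry_bell_matrix[OF f0, of "Suc N" "Suc (Suc K)"]
      entry_bell_matrix[OF f0, of N K]
      entry_bell_matrix[OF f0, of N "Suc K"]
      entry_bell_matrix[OF f0, of N "Suc (Suc K)"]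
    ultimately show ?thesis
      using NK by (simp add: t N K algebra_simps del: power_Suc)
  qed

  have "f = fps_X * ((1 + fps_X) / D * (catalan_gf oo w))"
    using D0 by (simp add: f_def p fps_divide_unit mult_ac)
  then have "f / fps_X = (1 + fps_X) / D * (catalan_gf oo w)"
    by (metis fps_X_neq_zero nonzero_mult_div_cancel_left)
  moreover have "fps_nth (f / fps_X) 0 \<noteq> 0"
    using f1 by (simp add: fps_div_fps_X_nth del: fps_divide_X)
  ultimately have "is_riordan_array t ((1 + fps_X) / D * (catalan_gf oo w))
      (fps_X * (1 + fps_X) / D * (catalan_gf oo w))"
    using f0 f1 unfolding is_riordan_array_def t bell_matrix_def f_def p_def by simp
  then show ?thesis
    using t00 t10 rec unfolding Let_def D_def w_def by blast
qed

end
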